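(* Let $(\mathbf{A},\tau)$ be an $n$-subtractive $T_0$-topological algebra. Then: (i) $a\in\Sigma_{\kappa(a)}$ for every $a\in A\setminus\{0\}$; (ii) $R_i\subseteq\Sigma_i$ for every $1\le i\le n-1$; (iii) $\Sigma_{n-1}=A\setminus\{0\}$.
   Context: $\mathbf{A}$ is $n$-subtractive ($n\ge2$) with constant $0$ and binary terms $s_1,\dots,s_{n-1}$ satisfying $s_1(x,x)=0$, $s_j(x,0)=s_{j+1}(x,x)$ ($j=1,\dots,n-2$), $s_{n-1}(x,0)=x$. A topological algebra has a topology making all basic operations continuous; $T_0$ refers to the topology. For $a\in A\setminus\{0\}$, the rank $\kappa(a)$ is the least $k\in\{1,\dots,n-1\}$ with $s_k(a,0)\ne0$. For $0\le i\le n-1$, $R_i=\{a\in A\setminus\{0\}:\kappa(a)\le i\}$ (so $R_0=\emptyset$). For $i\ge1$, $\Sigma_i=\{a\in A:\text{there exist open } U,V \text{ with } a\in U,\ 0\in V,\ U\cap V\subseteq R_{i-1}\}$. *)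

theory Defs
  imports "HOL-Analysis.Analysis"
begin

text \<open>
  An algebra is given by its carrier \<open>A\<close>, a type \<open>'f\<close> of operation symbols with arities \<open>ar\<close>, and an
  interpretation \<open>I\<close> of the symbols on argument lists. Only the values of \<open>I f\<close> on lists over \<open>A\<close> of
  length \<open>ar f\<close> matter.
\<close>

definition univ_algebra :: "'a set \<Rightarrow> ('f \<Rightarrow> nat) \<Rightarrow> ('f \<Rightarrow> 'a list \<Rightarrow> 'a) \<Rightarrow> bool" where
  "univ_algebra A ar I \<longleftrightarrow> (\<forall>f xs. set xs \<subseteq> A \<and> length xs = ar f \<longrightarrow> I f xs \<in> A)"

definition topological_algebra ::
    "'a set \<Rightarrow> ('f \<Rightarrow> nat) \<Rightarrow> ('f \<Rightarrow> 'a list \<Rightarrow> 'a) \<Rightarrow> 'a topology \<Rightarrow> bool" where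
  "topological_algebra A ar I X \<longleftrightarrow> univ_algebra A ar I \<and> topspace X = A \<and>
     (\<forall>f. continuous_map (product_topology (\<lambda>_. X) {..<ar f}) X (\<lambda>x. I f (map x [0..<ar f])))"

datatype 'f trm = Var nat | Op 'f "'f trm list"

primrec trm_vars :: "'f trm \<Rightarrow> nat set" where
  "trm_vars (Var i) = {i}"
| "trm_vars (Op f ts) = \<Union> (set (map trm_vars ts))"

primrec wf_trm :: "('f \<Rightarrow> nat) \<Rightarrow> 'f trm \<Rightarrow> bool" where
  "wf_trm ar (Var i) \<longleftrightarrow> True"
| "wf_trm ar (Op f ts) \<longleftrightarrow> length ts = ar f \<and> list_all (wf_trm ar) ts"

primrec trm_val :: "('f \<Rightarrow> 'a list \<Rightarrow> 'a) \<Rightarrow> (nat \<Rightarrow> 'a) \<Rightarrow> 'f trm \<Rightarrow> 'a" where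
  "trm_val I e (Var i) = e i"
| "trm_val I e (Op f ts) = I f (map (trm_val I e) ts)"

definition binary_trm :: "('f \<Rightarrow> nat) \<Rightarrow> 'f trm \<Rightarrow> bool" where
  "binary_trm ar t \<longleftrightarrow> wf_trm ar t \<and> trm_vars t \<subseteq> {0, 1}"

definition binary_val :: "('f \<Rightarrow> 'a list \<Rightarrow> 'a) \<Rightarrow> 'f trm \<Rightarrow> 'a \<Rightarrow> 'a \<Rightarrow> 'a" where
  "binary_val I t x y = trm_val I (\<lambda>i. if i = 0 then x else y) t"

text \<open>The constant is the nullary operation symbol \<open>c\<close>; its value in the algebra is \<open>I c []\<close>.
  The terms are \<open>s 1, \<dots>, s (n - 1)\<close>; other values of \<open>s\<close> are irrelevant.\<close>

definition n_subtractive ::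
    "nat \<Rightarrow> 'a set \<Rightarrow> ('f \<Rightarrow> nat) \<Rightarrow> ('f \<Rightarrow> 'a list \<Rightarrow> 'a) \<Rightarrow> 'f \<Rightarrow> (nat \<Rightarrow> 'f trm) \<Rightarrow> bool" where
  "n_subtractive n A ar I c s \<longleftrightarrow>
     n \<ge> 2 \<and> univ_algebra A ar I \<and> ar c = 0 \<and>
     (\<forall>j\<in>{1..n - 1}. binary_trm ar (s j)) \<and>
     (\<forall>x\<in>A. binary_val I (s 1) x x = I c []) \<and>
     (\<forall>j\<in>{1..n - 2}. \<forall>x\<in>A.
        binary_val I (s j) x (I c []) = binary_val I (s (j + 1)) x x) \<and>
     (\<forall>x\<in>A. binary_val I (s (n - 1)) x (I c []) = x)"

definition sub_rank ::
    "nat \<Rightarrow> ('f \<Rightarrow> 'a list \<Rightarrow> 'a) \<Rightarrow> 'f \<Rightarrow> (nat \<Rightarrow> 'f trm) \<Rightarrow> 'a \<Rightarrow> nat" where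
  "sub_rank n I c s a =
     (LEAST k. k \<in> {1..n - 1} \<and> binary_val I (s k) a (I c []) \<noteq> I c [])"

definition rank_le_set ::
    "nat \<Rightarrow> 'a set \<Rightarrow> ('f \<Rightarrow> 'a list \<Rightarrow> 'a) \<Rightarrow> 'f \<Rightarrow> (nat \<Rightarrow> 'f trm) \<Rightarrow> nat \<Rightarrow> 'a set" where
  "rank_le_set n A I c s i = {a \<in> A - {I c []}. sub_rank n I c s a \<le> i}"

text \<open>The set \<open>\<Sigma>\<^sub>i\<close>, meant for \<open>i \<ge> 1\<close> only.\<close>

definition sigma_set ::
    "nat \<Rightarrow> 'a set \<Rightarrow> ('f \<Rightarrow> 'a list \<Rightarrow> 'a) \<Rightarrow> 'f \<Rightarrow> (nat \<Rightarrow> 'f trm) \<Rightarrow> 'a topology \<Rightarrow> nat \<Rightarrow> 'a set" where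
  "sigma_set n A I c s X i =
     {a \<in> A. \<exists>U V. openin X U \<and> openin X V \<and> a \<in> U \<and> I c [] \<in> V \<and>
                 U \<inter> V \<subseteq> rank_le_set n A I c s (i - 1)}"

end

theory Submission
  imports Defs
begin

text \<open>
  If \<open>x\<close> is zero or has rank at least \<open>k\<close>, then \<open>s k x x = 0\<close>. Hence for nonzero \<open>b\<close> of rank \<open>m\<close> we have
  \<open>s m b b = 0\<close> and \<open>s m b 0 \<noteq> 0\<close>. The \<open>T\<^sub>0\<close> axiom separates \<open>s m b 0\<close> from \<open>0\<close> on one side; pulling
  back along \<open>y \<mapsto> s m y 0\<close> or \<open>y \<mapsto> s m b y\<close>, according to the side, yields in both cases an open set
  containing \<open>b\<close> but not \<open>0\<close>. Apply this to \<open>b = s k a 0\<close>, where \<open>k\<close> is the rank of \<open>a\<close>, to get \<open>W\<close>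
  open with \<open>s k a 0 \<in> W\<close> and \<open>0 \<notin> W\<close>. By continuity \<open>s k\<close> maps some \<open>U \<times> V\<close> into \<open>W\<close>, where \<open>a \<in> U\<close>
  and \<open>0 \<in> V\<close>. For \<open>x \<in> U \<inter> V\<close> then \<open>s k x x \<noteq> 0\<close>, so \<open>x\<close> is nonzero of rank less than \<open>k\<close>.
\<close>

lemma t0_space_open_separating_via_binary_map:
  assumes "t0_space Y"
    and left: "continuous_map X Y (\<lambda>x. f x z)" and right: "continuous_map X Y (f b)"
    and points: "b \<in> topspace X" "z \<in> topspace X"
    and diagonal: "f z z = f b b" and off_diagonal: "f b z \<noteq> f b b"
  obtains W where "openin X W" "b \<in> W" "z \<notin> W"
proof -
  have "f b z \<in> topspace Y" "f b b \<in> topspace Y"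
    using continuous_map_image_subset_topspace[OF right] points by auto
  then obtain V where V: "openin Y V" "f b z \<in> V \<longleftrightarrow> f b b \<notin> V"
    using \<open>t0_space Y\<close> off_diagonal unfolding t0_space_def by metis
  show thesis
  proof (cases "f b z \<in> V")
    case True
    show thesis
    proof (rule that)
      show "openin X {x \<in> topspace X. f x z \<in> V}"
        using left V(1) by (rule openin_continuous_map_preimage)
    qed (use True V(2) points diagonal in auto)
  next
    case False
    show thesis
    proof (rule that)
      show "openin X {x \<in> topspace X. f b x \<in> V}"
        using right V(1) by (rule openin_continuous_map_preimage)
    qed (use False V(2) points in auto)
  qed
qed

lemma continuous_map_prod_topology_open_rectangle:
  assumes "continuous_map (prod_topology X Y) Z f" and "openin Z W"
    and "x \<in> topspace X" "y \<in> topspace Y" "f (x, y) \<in> W"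
  obtains U V where "openin X U" "openin Y V" "x \<in> U" "y \<in> V" "f ` (U \<times> V) \<subseteq> W"
proof -
  let ?P = "{p \<in> topspace (prod_topology X Y). f p \<in> W}"
  have "openin (prod_topology X Y) ?P"
    using assms(1,2) by (rule openin_continuous_map_preimage)
  moreover have "(x, y) \<in> ?P"
    using assms by simp
  ultimately obtain U V where "openin X U" "openin Y V" "x \<in> U" "y \<in> V" "U \<times> V \<subseteq> ?P"
    unfolding openin_prod_topology_alt by meson
  then show thesis
    by (intro that) auto
qed

lemma trm_val_in_carrier:
  assumes "univ_algebra A ar I" and "\<And>i. e i \<in> A" and "wf_trm ar t"
  shows "trm_val I e t \<in> A"
  using assms(3)
proof (induction t)
  case (Var i)
  show ?case using assms(2) by simp
next
  case (Op f ts)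
  then have "set (map (trm_val I e) ts) \<subseteq> A" "length (map (trm_val I e) ts) = ar f"
    by (auto simp: list_all_iff)
  then show ?case
    using assms(1) unfolding univ_algebra_def trm_val.simps by blast
qed

lemma binary_val_in_carrier:
  assumes "univ_algebra A ar I" "wf_trm ar t" "x \<in> A" "y \<in> A"
  shows "binary_val I t x y \<in> A"
  unfolding binary_val_def by (rule trm_val_in_carrier[OF assms(1)]) (use assms in simp_all)

lemma continuous_map_trm_val:
  assumes alg: "topological_algebra A ar I X"
    and e: "\<And>i. continuous_map Y X (\<lambda>z. e z i)"
    and wf: "wf_trm ar t"
  shows "continuous_map Y X (\<lambda>z. trm_val I (e z) t)"
  using wf
proof (induction t)
  case (Var i)
  show ?case using e by simp
next
  case (Op f ts)
  have len: "length ts = ar f" and wfs: "\<And>t. t \<in> set ts \<Longrightarrow> wf_trm ar t"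
    using Op.prems by (auto simp: list_all_iff)
  let ?args = "\<lambda>z. \<lambda>i\<in>{..<ar f}. trm_val I (e z) (ts ! i)"
  have "continuous_map Y (product_topology (\<lambda>_. X) {..<ar f}) ?args"
    using Op.IH wfs len by (auto simp: continuous_map_componentwise)
  moreover have "continuous_map (product_topology (\<lambda>_. X) {..<ar f}) X (\<lambda>x. I f (map x [0..<ar f]))"
    using alg by (auto simp: topological_algebra_def)
  ultimately have "continuous_map Y X ((\<lambda>x. I f (map x [0..<ar f])) \<circ> ?args)"
    by (rule continuous_map_compose)
  moreover have "map (?args z) [0..<ar f] = map (trm_val I (e z)) ts" for z
    by (rule nth_equalityI) (simp_all add: len)
  ultimately show ?case
    by (simp add: o_def)
qed

lemma continuous_map_binary_val:
  assumes "topological_algebra A ar I X" "wf_trm ar t"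
    and "continuous_map Y X g" "continuous_map Y X h"
  shows "continuous_map Y X (\<lambda>z. binary_val I t (g z) (h z))"
  unfolding binary_val_def by (rule continuous_map_trm_val[OF assms(1)]) (use assms in simp_all)

lemma rank_le_set_mono:
  "i \<le> j \<Longrightarrow> rank_le_set n A I c s i \<subseteq> rank_le_set n A I c s j"
  by (auto simp: rank_le_set_def)

lemma sigma_set_mono:
  assumes "i \<le> j"
  shows "sigma_set n A I c s X i \<subseteq> sigma_set n A I c s X j"
proof -
  have "rank_le_set n A I c s (i - 1) \<subseteq> rank_le_set n A I c s (j - 1)"
    using assms by (intro rank_le_set_mono diff_le_mono)
  then show ?thesis
    unfolding sigma_set_def by blast
qed

lemma sigma_set_subset_nonzero: "sigma_set n A I c s X i \<subseteq> A - {I c []}"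
  by (auto simp: sigma_set_def rank_le_set_def)

locale n_subtractive_algebra =
  fixes n :: nat and A :: "'a set" and ar :: "'f \<Rightarrow> nat" and I :: "'f \<Rightarrow> 'a list \<Rightarrow> 'a"
    and c :: 'f and s :: "nat \<Rightarrow> 'f trm"
  assumes subtractive: "n_subtractive n A ar I c s"
begin

abbreviation zero :: 'a (\<open>\<zero>\<close>)
  where "\<zero> \<equiv> I c []"

abbreviation sub :: "nat \<Rightarrow> 'a \<Rightarrow> 'a \<Rightarrow> 'a"
  where "sub k \<equiv> binary_val I (s k)"

abbreviation \<kappa> :: "'a \<Rightarrow> nat"
  where "\<kappa> \<equiv> sub_rank n I c s"

abbreviation R :: "nat \<Rightarrow> 'a set"
  where "R \<equiv> rank_le_set n A I c s"

lemma zero_in_carrier: "\<zero> \<in> A"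
  using subtractive unfolding n_subtractive_def univ_algebra_def
  by (metis empty_set empty_subsetI list.size(3))

lemma wf_trm_sub: "k \<in> {1..n - 1} \<Longrightarrow> wf_trm ar (s k)"
  using subtractive by (simp add: n_subtractive_def binary_trm_def)

lemma sub_in_carrier:
  assumes "k \<in> {1..n - 1}" "x \<in> A" "y \<in> A"
  shows "sub k x y \<in> A"
  using subtractive wf_trm_sub assms by (auto simp: n_subtractive_def intro: binary_val_in_carrier)

lemma sub_1_self: "x \<in> A \<Longrightarrow> sub 1 x x = \<zero>"
  using subtractive unfolding n_subtractive_def by blast

lemma sub_Suc_self:
  assumes "1 \<le> k" "k < n - 1" "x \<in> A"
  shows "sub (Suc k) x x = sub k x \<zero>"
proof -
  have "k \<in> {1..n - 2}"
    using assms by simp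
  then show ?thesis
    using subtractive \<open>x \<in> A\<close> unfolding n_subtractive_def Suc_eq_plus1 by metis
qed

lemma sub_last_zero: "x \<in> A \<Longrightarrow> sub (n - 1) x \<zero> = x"
  using subtractive unfolding n_subtractive_def by blast

lemma two_le_n: "2 \<le> n"
  using subtractive unfolding n_subtractive_def by (rule conjunct1)

lemma sub_zero_zero:
  assumes "1 \<le> k" "k \<le> n - 1"
  shows "sub k \<zero> \<zero> = \<zero>"
  using assms
proof (induction k rule: dec_induct)
  case base
  show ?case using sub_1_self zero_in_carrier by simp
next
  case (step k)
  then show ?case using sub_Suc_self zero_in_carrier by simp
qed

lemma
  assumes "a \<in> A - {\<zero>}"
  shows rank_in_range: "\<kappa> a \<in> {1..n - 1}"
    and sub_at_rank_zero_neq_zero: "sub (\<kappa> a) a \<zero> \<noteq> \<zero>"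
proof -
  let ?P = "\<lambda>k. k \<in> {1..n - 1} \<and> sub k a \<zero> \<noteq> \<zero>"
  have "?P (n - 1)"
    using two_le_n sub_last_zero assms by simp
  then have "?P (LEAST k. ?P k)"
    by (rule LeastI)
  then show "\<kappa> a \<in> {1..n - 1}" "sub (\<kappa> a) a \<zero> \<noteq> \<zero>"
    by (simp_all add: sub_rank_def)
qed

lemma sub_zero_below_rank:
  assumes "k < \<kappa> a" "k \<in> {1..n - 1}"
  shows "sub k a \<zero> = \<zero>"
  using not_less_Least[OF assms(1)[unfolded sub_rank_def]] assms(2) by blast

lemma sub_self_eq_zero:
  assumes "x \<in> A" "k \<in> {1..n - 1}" "x \<notin> R (k - 1)"
  shows "sub k x x = \<zero>"
proof (cases "x = \<zero> \<or> k = 1")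
  case True
  then show ?thesis using sub_zero_zero sub_1_self assms by auto
next
  case False
  then obtain j where j: "k = Suc j" "1 \<le> j" "j < n - 1"
    using assms(2) by (cases k) auto
  moreover have "j < \<kappa> x"
    using False assms(1,3) j by (auto simp: rank_le_set_def)
  ultimately show ?thesis
    using sub_Suc_self sub_zero_below_rank assms(1) by simp
qed

lemma sub_at_rank_self:
  assumes "a \<in> A - {\<zero>}"
  shows "sub (\<kappa> a) a a = \<zero>"
  using sub_self_eq_zero[OF _ rank_in_range[OF assms]] rank_in_range[OF assms] assms
  by (auto simp: rank_le_set_def)

lemma rank_le_set_last: "R (n - 1) = A - {\<zero>}"
  using rank_in_range by (auto simp: rank_le_set_def)

end

locale n_subtractive_topological_algebra = n_subtractive_algebra n A ar I c s
  for n :: nat and A :: "'a set" and ar :: "'f \<Rightarrow> nat" and I :: "'f \<Rightarrow> 'a list \<Rightarrow> 'a"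
    and c :: 'f and s :: "nat \<Rightarrow> 'f trm" +
  fixes X :: "'a topology"
  assumes topological: "topological_algebra A ar I X"
begin

abbreviation \<Sigma> :: "nat \<Rightarrow> 'a set"
  where "\<Sigma> \<equiv> sigma_set n A I c s X"

lemma topspace_eq_carrier: "topspace X = A"
  using topological by (simp add: topological_algebra_def)

lemma continuous_map_sub:
  assumes "k \<in> {1..n - 1}" "continuous_map Y X g" "continuous_map Y X h"
  shows "continuous_map Y X (\<lambda>y. sub k (g y) (h y))"
  using continuous_map_binary_val[OF topological wf_trm_sub] assms .

lemma open_nbhd_avoiding_zero:
  assumes "t0_space X" and b: "b \<in> A - {\<zero>}"
  obtains W where "openin X W" "b \<in> W" "\<zero> \<notin> W"
proof (rule t0_space_open_separating_via_binary_map[OF \<open>t0_space X\<close>])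
  show "continuous_map X X (\<lambda>x. sub (\<kappa> b) x \<zero>)" "continuous_map X X (sub (\<kappa> b) b)"
    by (rule continuous_map_sub[OF rank_in_range[OF b]];
        use b in \<open>simp add: topspace_eq_carrier zero_in_carrier\<close>)+
  show "sub (\<kappa> b) \<zero> \<zero> = sub (\<kappa> b) b b" "sub (\<kappa> b) b \<zero> \<noteq> sub (\<kappa> b) b b"
    using sub_zero_zero rank_in_range[OF b] sub_at_rank_self[OF b] sub_at_rank_zero_neq_zero[OF b]
    by simp_all
qed (use b topspace_eq_carrier zero_in_carrier that in auto)

lemma in_sigma_set_if_open_avoiding_zero:
  assumes a: "a \<in> A" and k: "k \<in> {1..n - 1}"
    and W: "openin X W" "sub k a \<zero> \<in> W" "\<zero> \<notin> W"
  shows "a \<in> \<Sigma> k"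
proof -
  have "continuous_map (prod_topology X X) X (\<lambda>p. sub k (fst p) (snd p))"
    using k continuous_map_fst continuous_map_snd by (rule continuous_map_sub)
  then obtain U V where UV: "openin X U" "openin X V" "a \<in> U" "\<zero> \<in> V"
    and rectangle: "(\<lambda>p. sub k (fst p) (snd p)) ` (U \<times> V) \<subseteq> W"
    using W a zero_in_carrier topspace_eq_carrier
    by (elim continuous_map_prod_topology_open_rectangle[where x = a and y = \<zero>]) auto
  have "x \<in> R (k - 1)" if x: "x \<in> U \<inter> V" for x
  proof (rule ccontr)
    assume "x \<notin> R (k - 1)"
    then have "sub k x x = \<zero>"
      using sub_self_eq_zero k x openin_subset[OF UV(1)] topspace_eq_carrier by blast
    moreover have "sub k x x \<in> W"
      using rectangle x by force
    ultimately show False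
      using W(3) by simp
  qed
  then show ?thesis
    using a UV unfolding sigma_set_def by blast
qed

lemma in_sigma_set_rank:
  assumes "t0_space X" and a: "a \<in> A - {\<zero>}"
  shows "a \<in> \<Sigma> (\<kappa> a)"
proof -
  have "sub (\<kappa> a) a \<zero> \<in> A - {\<zero>}"
    using sub_in_carrier sub_at_rank_zero_neq_zero rank_in_range zero_in_carrier a by simp
  then obtain W where "openin X W" "sub (\<kappa> a) a \<zero> \<in> W" "\<zero> \<notin> W"
    using open_nbhd_avoiding_zero \<open>t0_space X\<close> by blast
  then show ?thesis
    using in_sigma_set_if_open_avoiding_zero rank_in_range a by blast
qed

lemma rank_le_set_subset_sigma_set:
  assumes "t0_space X"
  shows "R i \<subseteq> \<Sigma> i"
proof
  fix a assume "a \<in> R i"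
  then have a: "a \<in> A - {\<zero>}" and rank: "\<kappa> a \<le> i"
    by (auto simp: rank_le_set_def)
  show "a \<in> \<Sigma> i"
    using sigma_set_mono[OF rank] in_sigma_set_rank[OF assms a] by (rule subsetD)
qed

lemma sigma_set_last:
  assumes "t0_space X"
  shows "\<Sigma> (n - 1) = A - {\<zero>}"
  using rank_le_set_subset_sigma_set[OF assms, of "n - 1"] sigma_set_subset_nonzero
  unfolding rank_le_set_last by (rule subset_antisym[rotated])

end

theorem theorem6p18:
  fixes n :: nat and A :: "'a set" and ar :: "'f \<Rightarrow> nat" and I :: "'f \<Rightarrow> 'a list \<Rightarrow> 'a"
    and c :: 'f and s :: "nat \<Rightarrow> 'f trm" and X :: "'a topology"
  assumes "n_subtractive n A ar I c s"
    and "topological_algebra A ar I X"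
    and "t0_space X"
  shows "(\<forall>a\<in>A - {I c []}. a \<in> sigma_set n A I c s X (sub_rank n I c s a)) \<and>
         (\<forall>i\<in>{1..n - 1}. rank_le_set n A I c s i \<subseteq> sigma_set n A I c s X i) \<and>
         sigma_set n A I c s X (n - 1) = A - {I c []}"
proof -
  interpret n_subtractive_topological_algebra n A ar I c s X
    using assms(1,2) by unfold_locales
  show ?thesis
    using in_sigma_set_rank rank_le_set_subset_sigma_set sigma_set_last \<open>t0_space X\<close> by blast
qed

end
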